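(* Let $(\Phi,\{\Pi_\varphi\}_{\varphi\in\Phi})$ be a t-stability on a triangulated category $\mathcal{T}$. Then the HN-system of any nonzero object $X\in\mathcal{T}$ is determined up to a unique isomorphism of Postnikov systems. That is: if $F^{i+1}X\to F^iX\to X_{\varphi_i}\to F^{i+1}X[1]$ ($0\le i\le n$) and $Q^{j+1}X\to Q^jX\to X'_{\psi_j}\to Q^{j+1}X[1]$ ($0\le j\le m$) are two HN-systems of $X$, then $n=m$, $\varphi_i=\psi_i$ for all $i$, and there is a unique collection of isomorphisms $a_i:F^iX\to Q^iX$ ($0\le i\le n+1$) and $b_i:X_{\varphi_i}\to X'_{\psi_i}$ ($0\le i\le n$) with $a_0=\mathrm{id}_X$ such that for each $i$ the triple $(a_{i+1},a_i,b_i)$ is a morphism of the corresponding distinguished triangles.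
   Context: Write $\mathrm{Hom}^i(X,Y)=\mathrm{Hom}_{\mathcal{T}}(X,Y[i])$; $\mathrm{Hom}^{\le 0}(\mathcal{X},\mathcal{Y})=0$ means $\mathrm{Hom}^i(X,Y)=0$ for all $i\le 0$, $X\in\mathcal{X}$, $Y\in\mathcal{Y}$. A subcategory $\mathcal{X}\subset\mathcal{T}$ is extension-closed if for every distinguished triangle $A\to B\to C\to A[1]$ with $A,C\in\mathcal{X}$ also $B\in\mathcal{X}$. A t-stability on $\mathcal{T}$ is a pair $(\Phi,\{\Pi_\varphi\}_{\varphi\in\Phi})$, where $\Phi$ is a linearly ordered set and each $\Pi_\varphi\subset\mathcal{T}$ is a nonempty, strictly full (full and closed under isomorphisms), extension-closed subcategory, such that: (1) there is an automorphism $\tau$ of the ordered set $\Phi$ with $\Pi_\varphi[1]=\Pi_{\tau(\varphi)}$ and $\tau(\varphi)\ge\varphi$ for all $\varphi$; (2) $\mathrm{Hom}^{\le 0}(\Pi_\psi,\Pi_\varphi)=0$ whenever $\psi>\varphi$; (3) every nonzero $X\in\mathcal{T}$ has an HN-system, i.e. a finite system of distinguished triangles $F^{i+1}X\to F^iX\to X_{\varphi_i}\to F^{i+1}X[1]$, $0\le i\le n$, with $F^0X=X$, $F^{n+1}X=0$, $0\ne X_{\varphi_i}\in\Pi_{\varphi_i}$ and $\varphi_0<\varphi_1<\dots<\varphi_n$. *)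

theory Defs
  imports "HOL-Algebra.Group"
begin

section \<open>Categories\<close>

record ('o, 'm) category =
  Obj :: "'o set"
  Arr :: "'m set"
  source :: "'m \<Rightarrow> 'o"
  target :: "'m \<Rightarrow> 'o"
  ident :: "'o \<Rightarrow> 'm"
  Comp :: "'m \<Rightarrow> 'm \<Rightarrow> 'm" (infixr "\<cdot>\<index>" 70)

definition Hom :: "('o, 'm, 'x) category_scheme \<Rightarrow> 'o \<Rightarrow> 'o \<Rightarrow> 'm set"
  where "Hom C X Y = {f \<in> Arr C. source C f = X \<and> target C f = Y}"

locale category =
  fixes C :: "('o, 'm, 'x) category_scheme" (structure)
  assumes source_closed: "f \<in> Arr C \<Longrightarrow> source C f \<in> Obj C"
    and target_closed: "f \<in> Arr C \<Longrightarrow> target C f \<in> Obj C"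
    and ident_Hom: "X \<in> Obj C \<Longrightarrow> ident C X \<in> Hom C X X"
    and Comp_Hom: "\<lbrakk>f \<in> Hom C X Y; g \<in> Hom C Y Z\<rbrakk> \<Longrightarrow> g \<cdot> f \<in> Hom C X Z"
    and Comp_ident_right: "f \<in> Hom C X Y \<Longrightarrow> f \<cdot> ident C X = f"
    and Comp_ident_left: "f \<in> Hom C X Y \<Longrightarrow> ident C Y \<cdot> f = f"
    and Comp_assoc: "\<lbrakk>f \<in> Hom C W X; g \<in> Hom C X Y; h \<in> Hom C Y Z\<rbrakk>
      \<Longrightarrow> (h \<cdot> g) \<cdot> f = h \<cdot> (g \<cdot> f)"

definition Iso :: "('o, 'm, 'x) category_scheme \<Rightarrow> 'o \<Rightarrow> 'o \<Rightarrow> 'm set"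
  where "Iso C X Y = {f \<in> Hom C X Y. \<exists>g \<in> Hom C Y X.
    g \<cdot>\<^bsub>C\<^esub> f = ident C X \<and> f \<cdot>\<^bsub>C\<^esub> g = ident C Y}"

definition zero_object :: "('o, 'm, 'x) category_scheme \<Rightarrow> 'o \<Rightarrow> bool"
  where "zero_object C Z \<longleftrightarrow> Z \<in> Obj C \<and>
    (\<forall>X \<in> Obj C. (\<exists>!f. f \<in> Hom C X Z) \<and> (\<exists>!f. f \<in> Hom C Z X))"

section \<open>Additive categories\<close>

record ('o, 'm) additive_category = "('o, 'm) category" +
  Add :: "'m \<Rightarrow> 'm \<Rightarrow> 'm"
  Zero :: "'o \<Rightarrow> 'o \<Rightarrow> 'm"

text \<open>The additive group \<open>Hom(X, Y)\<close>, in the multiplicative notation of HOL-Algebra.\<close>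

definition hom_group :: "('o, 'm, 'x) additive_category_scheme \<Rightarrow> 'o \<Rightarrow> 'o \<Rightarrow> 'm monoid"
  where "hom_group C X Y = \<lparr>carrier = Hom C X Y, mult = Add C, one = Zero C X Y\<rparr>"

definition Neg :: "('o, 'm, 'x) additive_category_scheme \<Rightarrow> 'm \<Rightarrow> 'm"
  where "Neg C f = inv\<^bsub>hom_group C (source C f) (target C f)\<^esub> f"

definition biproduct ::
    "('o, 'm, 'x) additive_category_scheme \<Rightarrow> 'o \<Rightarrow> 'o \<Rightarrow> 'o \<Rightarrow> bool"
  where "biproduct C X Y P \<longleftrightarrow> P \<in> Obj C \<and>
    (\<exists>i \<in> Hom C X P. \<exists>j \<in> Hom C Y P. \<exists>p \<in> Hom C P X. \<exists>q \<in> Hom C P Y.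
      p \<cdot>\<^bsub>C\<^esub> i = ident C X \<and> q \<cdot>\<^bsub>C\<^esub> j = ident C Y \<and>
      p \<cdot>\<^bsub>C\<^esub> j = Zero C Y X \<and> q \<cdot>\<^bsub>C\<^esub> i = Zero C X Y \<and>
      Add C (i \<cdot>\<^bsub>C\<^esub> p) (j \<cdot>\<^bsub>C\<^esub> q) = ident C P)"

locale additive_category = category C
  for C :: "('o, 'm, 'x) additive_category_scheme" (structure) +
  assumes hom_comm_group: "\<lbrakk>X \<in> Obj C; Y \<in> Obj C\<rbrakk> \<Longrightarrow> comm_group (hom_group C X Y)"
    and Comp_Add_right: "\<lbrakk>f \<in> Hom C X Y; g \<in> Hom C X Y; h \<in> Hom C Y Z\<rbrakk>
      \<Longrightarrow> h \<cdot> Add C f g = Add C (h \<cdot> f) (h \<cdot> g)"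
    and Comp_Add_left: "\<lbrakk>f \<in> Hom C X Y; g \<in> Hom C Y Z; h \<in> Hom C Y Z\<rbrakk>
      \<Longrightarrow> Add C g h \<cdot> f = Add C (g \<cdot> f) (h \<cdot> f)"
    and ex_zero_object: "\<exists>Z. zero_object C Z"
    and ex_biproduct: "\<lbrakk>X \<in> Obj C; Y \<in> Obj C\<rbrakk> \<Longrightarrow> \<exists>P. biproduct C X Y P"

section \<open>Triangulated categories\<close>

text \<open>
  The translation functor is an additive automorphism (not merely an autoequivalence), with
  object part \<open>Sh\<close> and arrow part \<open>ShA\<close>.  A triangle \<open>X \<rightarrow> Y \<rightarrow> Z \<rightarrow> X[1]\<close> is given by its three
  arrows, since these determine the objects.
\<close>

record ('o, 'm) triangulated_category = "('o, 'm) additive_category" +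
  Sh :: "'o \<Rightarrow> 'o"
  ShA :: "'m \<Rightarrow> 'm"
  Dist :: "('m \<times> 'm \<times> 'm) set"

definition triangle ::
    "('o, 'm, 'x) triangulated_category_scheme \<Rightarrow> 'o \<Rightarrow> 'o \<Rightarrow> 'o \<Rightarrow> 'm \<times> 'm \<times> 'm \<Rightarrow> bool"
  where "triangle C X Y Z = (\<lambda>(u, v, w).
    u \<in> Hom C X Y \<and> v \<in> Hom C Y Z \<and> w \<in> Hom C Z (Sh C X))"

definition dist_triangle ::
    "('o, 'm, 'x) triangulated_category_scheme \<Rightarrow> 'o \<Rightarrow> 'o \<Rightarrow> 'o \<Rightarrow> 'm \<times> 'm \<times> 'm \<Rightarrow> bool"
  where "dist_triangle C X Y Z t \<longleftrightarrow> triangle C X Y Z t \<and> t \<in> Dist C"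

definition triangle_map :: "('o, 'm, 'x) triangulated_category_scheme
    \<Rightarrow> 'm \<times> 'm \<times> 'm \<Rightarrow> 'm \<times> 'm \<times> 'm \<Rightarrow> 'm \<Rightarrow> 'm \<Rightarrow> 'm \<Rightarrow> bool"
  where "triangle_map C = (\<lambda>(u, v, w) (u', v', w') a b c.
    a \<in> Hom C (source C u) (source C u') \<and>
    b \<in> Hom C (source C v) (source C v') \<and>
    c \<in> Hom C (source C w) (source C w') \<and>
    b \<cdot>\<^bsub>C\<^esub> u = u' \<cdot>\<^bsub>C\<^esub> a \<and> c \<cdot>\<^bsub>C\<^esub> v = v' \<cdot>\<^bsub>C\<^esub> b \<and> ShA C a \<cdot>\<^bsub>C\<^esub> w = w' \<cdot>\<^bsub>C\<^esub> c)"

locale triangulated_category = additive_category C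
  for C :: "('o, 'm, 'x) triangulated_category_scheme" (structure) +
  assumes Sh_bij: "bij_betw (Sh C) (Obj C) (Obj C)"
    and ShA_bij: "bij_betw (ShA C) (Arr C) (Arr C)"
    and ShA_Hom: "f \<in> Hom C X Y \<Longrightarrow> ShA C f \<in> Hom C (Sh C X) (Sh C Y)"
    and ShA_ident: "X \<in> Obj C \<Longrightarrow> ShA C (ident C X) = ident C (Sh C X)"
    and ShA_Comp: "\<lbrakk>f \<in> Hom C X Y; g \<in> Hom C Y Z\<rbrakk> \<Longrightarrow> ShA C (g \<cdot> f) = ShA C g \<cdot> ShA C f"
    and ShA_Add: "\<lbrakk>f \<in> Hom C X Y; g \<in> Hom C X Y\<rbrakk>
      \<Longrightarrow> ShA C (Add C f g) = Add C (ShA C f) (ShA C g)"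
    and Dist_triangle: "t \<in> Dist C \<Longrightarrow> \<exists>X Y Z. triangle C X Y Z t"
    and TR1_iso: "\<lbrakk>dist_triangle C X Y Z t; triangle C X' Y' Z' t'; triangle_map C t t' a b c;
        a \<in> Iso C X X'; b \<in> Iso C Y Y'; c \<in> Iso C Z Z'\<rbrakk> \<Longrightarrow> t' \<in> Dist C"
    and TR1_ident: "\<lbrakk>X \<in> Obj C; zero_object C Z\<rbrakk>
      \<Longrightarrow> (ident C X, Zero C X Z, Zero C Z (Sh C X)) \<in> Dist C"
    and TR1_cone: "u \<in> Hom C X Y \<Longrightarrow> \<exists>Z v w. dist_triangle C X Y Z (u, v, w)"
    and TR2: "triangle C X Y Z (u, v, w)
      \<Longrightarrow> (u, v, w) \<in> Dist C \<longleftrightarrow> (v, w, Neg C (ShA C u)) \<in> Dist C"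
    and TR3: "\<lbrakk>dist_triangle C X Y Z (u, v, w); dist_triangle C X' Y' Z' (u', v', w');
        a \<in> Hom C X X'; b \<in> Hom C Y Y'; b \<cdot> u = u' \<cdot> a\<rbrakk>
      \<Longrightarrow> \<exists>c. triangle_map C (u, v, w) (u', v', w') a b c"
    and TR4: "\<lbrakk>dist_triangle C X Y Z' (u, j, k); dist_triangle C Y Z X' (v, l, i);
        dist_triangle C X Z Y' (v \<cdot> u, m, n)\<rbrakk>
      \<Longrightarrow> \<exists>f g. dist_triangle C Z' Y' X' (f, g, ShA C j \<cdot> i) \<and>
            f \<cdot> j = m \<cdot> v \<and> n \<cdot> f = k \<and> g \<cdot> m = l \<and> i \<cdot> g = ShA C u \<cdot> n"

definition shift :: "('o, 'm, 'x) triangulated_category_scheme \<Rightarrow> int \<Rightarrow> 'o \<Rightarrow> 'o"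
  where "shift C i X = (if i \<ge> 0 then (Sh C ^^ nat i) X
    else (inv_into (Obj C) (Sh C) ^^ nat (- i)) X)"

section \<open>t-stabilities\<close>

text \<open>Full subcategories are represented by their sets of objects.\<close>

definition strictly_full :: "('o, 'm, 'x) category_scheme \<Rightarrow> 'o set \<Rightarrow> bool"
  where "strictly_full C S \<longleftrightarrow> S \<subseteq> Obj C \<and>
    (\<forall>X \<in> S. \<forall>Y \<in> Obj C. Iso C X Y \<noteq> {} \<longrightarrow> Y \<in> S)"

definition extension_closed ::
    "('o, 'm, 'x) triangulated_category_scheme \<Rightarrow> 'o set \<Rightarrow> bool"
  where "extension_closed C S \<longleftrightarrow>
    (\<forall>X Y Z t. dist_triangle C X Y Z t \<longrightarrow> X \<in> S \<longrightarrow> Z \<in> S \<longrightarrow> Y \<in> S)"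

text \<open>
  The system of triangles \<open>F\<^sup>i\<^sup>+\<^sup>1X \<rightarrow> F\<^sup>iX \<rightarrow> X\<^sub>i \<rightarrow> F\<^sup>i\<^sup>+\<^sup>1X[1]\<close> for \<open>0 \<le> i \<le> n\<close>.  Only
  \<open>filt i\<close> for \<open>i \<le> n + 1\<close>, and \<open>factor i\<close>, \<open>phase i\<close>, \<open>tri i\<close> for \<open>i \<le> n\<close>, are meaningful,
  where \<open>n = top_index\<close>.
\<close>

record ('o, 'm, 'p) hn_data =
  top_index :: nat
  filt :: "nat \<Rightarrow> 'o"
  factor :: "nat \<Rightarrow> 'o"
  phase :: "nat \<Rightarrow> 'p"
  tri :: "nat \<Rightarrow> 'm \<times> 'm \<times> 'm"

definition hn_system :: "('o, 'm, 'x) triangulated_category_scheme \<Rightarrow> 'p::linorder set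
    \<Rightarrow> ('p \<Rightarrow> 'o set) \<Rightarrow> 'o \<Rightarrow> ('o, 'm, 'p) hn_data \<Rightarrow> bool"
  where "hn_system C \<Phi> P X H \<longleftrightarrow>
    filt H 0 = X \<and> zero_object C (filt H (top_index H + 1)) \<and>
    (\<forall>i \<le> top_index H.
      dist_triangle C (filt H (i + 1)) (filt H i) (factor H i) (tri H i) \<and>
      phase H i \<in> \<Phi> \<and> factor H i \<in> P (phase H i) \<and> \<not> zero_object C (factor H i)) \<and>
    strict_mono_on {..top_index H} (phase H)"

text \<open>
  The index set is a subset \<open>\<Phi>\<close> of a linearly ordered type.  A strictly monotone bijection of a
  linear order onto itself is an order automorphism.
\<close>

locale t_stability = triangulated_category C
  for C :: "('o, 'm, 'x) triangulated_category_scheme" (structure) +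
  fixes \<Phi> :: "'p::linorder set" and P :: "'p \<Rightarrow> 'o set"
  assumes nonempty: "\<phi> \<in> \<Phi> \<Longrightarrow> P \<phi> \<noteq> {}"
    and strictly_full: "\<phi> \<in> \<Phi> \<Longrightarrow> strictly_full C (P \<phi>)"
    and extension_closed: "\<phi> \<in> \<Phi> \<Longrightarrow> extension_closed C (P \<phi>)"
    and shift_phases: "\<exists>\<tau>. bij_betw \<tau> \<Phi> \<Phi> \<and> strict_mono_on \<Phi> \<tau> \<and>
      (\<forall>\<phi> \<in> \<Phi>. Sh C ` P \<phi> = P (\<tau> \<phi>) \<and> \<tau> \<phi> \<ge> \<phi>)"
    and Hom_vanish: "\<lbrakk>\<phi> \<in> \<Phi>; \<psi> \<in> \<Phi>; \<psi> > \<phi>; X \<in> P \<psi>; Y \<in> P \<phi>; i \<le> 0\<rbrakk>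
      \<Longrightarrow> Hom C X (shift C i Y) = {Zero C X (shift C i Y)}"
    and ex_hn_system: "\<lbrakk>X \<in> Obj C; \<not> zero_object C X\<rbrakk> \<Longrightarrow> \<exists>H. hn_system C \<Phi> P X H"

end

theory Submission
  imports Defs
begin

text \<open>
  Everything rests on one comparison of two distinguished triangles
  \<open>A \<rightarrow> X \<rightarrow> B \<rightarrow> A[1]\<close> and \<open>A' \<rightarrow> X' \<rightarrow> B' \<rightarrow> A'[1]\<close>.  If \<open>Hom(A, B') = 0\<close>, then for every
  \<open>h : X \<rightarrow> X'\<close> the composite \<open>A \<rightarrow> X \<rightarrow> X' \<rightarrow> B'\<close> vanishes, so \<open>h\<close> lifts to \<open>A \<rightarrow> A'\<close> and the
  lift extends to a morphism of triangles.  If moreover \<open>Hom(A[1], B') = 0\<close>, two such morphisms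
  are equal, because their differences on \<open>A[1]\<close> and on \<open>B\<close> factor through \<open>A[1] \<rightarrow> B'\<close>.  By
  uniqueness, an isomorphism \<open>h\<close> extends to an isomorphism of triangles as soon as all four
  pairs formed from \<open>A, A'\<close> and \<open>B, B'\<close> satisfy both conditions
  (lemma \<open>ex1_triangle_map\<close> and lemma \<open>triangle_map_Iso\<close>).

  In an HN-system the subobject \<open>F\<^sup>k\<^sup>+\<^sup>1X\<close> is an iterated extension of factors whose phases exceed
  that of \<open>X\<^sub>k\<close>.  The axiom \<open>Hom\<^sup>\<le>\<^sup>0(\<Pi>\<^sub>\<psi>, \<Pi>\<^sub>\<phi>) = 0\<close>, used in degrees \<open>0\<close> and \<open>-1\<close>, gives the
  two conditions for any factor of the phase of \<open>X\<^sub>k\<close>.  The same vanishing forces the phases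
  to agree: were \<open>F\<^sup>k \<cong> Q\<^sup>k\<close> and \<open>\<phi>\<^sub>k < \<psi>\<^sub>k\<close>, the map \<open>F\<^sup>kX \<rightarrow> X\<^sub>k\<close> would be zero, hence
  \<open>X\<^sub>k \<rightarrow> F\<^sup>k\<^sup>+\<^sup>1X[1]\<close> a split monomorphism whose retraction lies in a zero Hom group, and
  \<open>X\<^sub>k\<close> would be zero (lemma \<open>zero_object_if_projection_zero\<close>).  Starting from \<open>id\<^sub>X\<close> and
  descending the filtrations one step at a time produces the isomorphism of Postnikov systems
  together with its uniqueness.
\<close>

section \<open>Isomorphisms and zero objects\<close>

context category
begin

lemma Hom_Obj: "f \<in> Hom C X Y \<Longrightarrow> X \<in> Obj C \<and> Y \<in> Obj C"
  using source_closed target_closed by (auto simp: Hom_def)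

lemma ident_Iso: "X \<in> Obj C \<Longrightarrow> ident C X \<in> Iso C X X"
  using ident_Hom Comp_ident_left unfolding Iso_def by blast

lemma Iso_inverseE:
  assumes "f \<in> Iso C X Y"
  obtains g where "f \<in> Hom C X Y" "g \<in> Hom C Y X" "g \<in> Iso C Y X"
    "g \<cdot> f = ident C X" "f \<cdot> g = ident C Y"
  using assms unfolding Iso_def by blast

lemma zero_object_Iso:
  assumes f: "f \<in> Iso C X Y" and Y: "zero_object C Y"
  shows "zero_object C X"
proof -
  obtain g where f: "f \<in> Hom C X Y" and g: "g \<in> Hom C Y X"
    and gf: "g \<cdot> f = ident C X"
    using f by (rule Iso_inverseE)
  have X: "X \<in> Obj C" using Hom_Obj f by blast
  have "\<exists>!h. h \<in> Hom C W X" if W: "W \<in> Obj C" for W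
  proof -
    obtain t where t: "t \<in> Hom C W Y" "\<And>t'. t' \<in> Hom C W Y \<Longrightarrow> t' = t"
      using Y W unfolding zero_object_def by metis
    have "h = g \<cdot> t" if h: "h \<in> Hom C W X" for h
      using Comp_assoc[OF h f g] gf Comp_ident_left[OF h] t(2)[OF Comp_Hom[OF h f]] by simp
    with Comp_Hom[OF t(1) g] show ?thesis by (rule ex1I)
  qed
  moreover have "\<exists>!h. h \<in> Hom C X W" if W: "W \<in> Obj C" for W
  proof -
    obtain t where t: "t \<in> Hom C Y W" "\<And>t'. t' \<in> Hom C Y W \<Longrightarrow> t' = t"
      using Y W unfolding zero_object_def by metis
    have "h = t \<cdot> f" if h: "h \<in> Hom C X W" for h
      using Comp_assoc[OF f g h] gf Comp_ident_right[OF h] t(2)[OF Comp_Hom[OF g h]] by simp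
    with Comp_Hom[OF f t(1)] show ?thesis by (rule ex1I)
  qed
  ultimately show ?thesis using X unfolding zero_object_def by blast
qed

end

section \<open>Zero morphisms and negatives\<close>

context additive_category
begin

lemma hom_group_simps [simp]:
  "carrier (hom_group C X Y) = Hom C X Y"
  "mult (hom_group C X Y) = Add C"
  "one (hom_group C X Y) = Zero C X Y"
  by (simp_all add: hom_group_def)

lemma group_hom_group:
  assumes "f \<in> Hom C X Y" shows "group (hom_group C X Y)"
  using hom_comm_group Hom_Obj[OF assms] by (simp add: comm_group.axioms)

lemma Zero_Hom: "\<lbrakk>X \<in> Obj C; Y \<in> Obj C\<rbrakk> \<Longrightarrow> Zero C X Y \<in> Hom C X Y"
  using monoid.one_closed[of "hom_group C X Y"] hom_comm_group[of X Y]
  by (simp add: comm_group.axioms group.is_monoid)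

lemma Add_Hom:
  assumes "f \<in> Hom C X Y" "g \<in> Hom C X Y" shows "Add C f g \<in> Hom C X Y"
  using monoid.m_closed[OF group.is_monoid[OF group_hom_group[OF assms(1)]], of f g] assms by simp

lemma Add_Zero:
  assumes "f \<in> Hom C X Y" shows "Add C f (Zero C X Y) = f"
  using monoid.r_one[OF group.is_monoid[OF group_hom_group[OF assms]]] assms by simp

lemma Zero_if_idem:
  assumes "f \<in> Hom C X Y" "Add C f f = f" shows "f = Zero C X Y"
  using group.l_cancel_one[OF group_hom_group[OF assms(1)], of f f] assms by simp

lemma Neg_eq_inv: "f \<in> Hom C X Y \<Longrightarrow> Neg C f = inv\<^bsub>hom_group C X Y\<^esub> f"
  by (auto simp: Neg_def Hom_def)

lemma Neg_Hom:
  assumes "f \<in> Hom C X Y" shows "Neg C f \<in> Hom C X Y"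
  using group.inv_closed[OF group_hom_group[OF assms]] assms by (simp add: Neg_eq_inv)

lemma Add_Neg:
  assumes "f \<in> Hom C X Y" shows "Add C f (Neg C f) = Zero C X Y"
  using group.r_inv[OF group_hom_group[OF assms]] assms by (simp add: Neg_eq_inv)

lemma Neg_unique:
  assumes "f \<in> Hom C X Y" "g \<in> Hom C X Y" "Add C f g = Zero C X Y" shows "g = Neg C f"
proof -
  interpret comm_group "hom_group C X Y"
    using hom_comm_group Hom_Obj[OF assms(1)] by blast
  show ?thesis
    using inv_equality[of g f] assms m_comm[of f g] by (simp add: Neg_eq_inv)
qed

lemma Neg_Neg:
  assumes "f \<in> Hom C X Y" shows "Neg C (Neg C f) = f"
  using group.inv_inv[OF group_hom_group[OF assms]] assms Neg_Hom[OF assms]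
  by (simp add: Neg_eq_inv)

lemma Comp_Zero_right:
  assumes "X \<in> Obj C" "h \<in> Hom C Y Z" shows "h \<cdot> Zero C X Y = Zero C X Z"
proof -
  have z: "Zero C X Y \<in> Hom C X Y" using Zero_Hom Hom_Obj assms by blast
  show ?thesis
    using Comp_Add_right[OF z z assms(2)] Add_Zero[OF z] Zero_if_idem[OF Comp_Hom[OF z assms(2)]]
    by simp
qed

lemma Comp_Zero_left:
  assumes "f \<in> Hom C X Y" "Z \<in> Obj C" shows "Zero C Y Z \<cdot> f = Zero C X Z"
proof -
  have z: "Zero C Y Z \<in> Hom C Y Z" using Zero_Hom Hom_Obj assms by blast
  show ?thesis
    using Comp_Add_left[OF assms(1) z z] Add_Zero[OF z] Zero_if_idem[OF Comp_Hom[OF assms(1) z]]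
    by simp
qed

lemma Comp_Neg_right:
  assumes f: "f \<in> Hom C X Y" and h: "h \<in> Hom C Y Z" shows "h \<cdot> Neg C f = Neg C (h \<cdot> f)"
  using Comp_Add_right[OF f Neg_Hom[OF f] h] Add_Neg[OF f] Comp_Zero_right[OF _ h]
    Hom_Obj[OF f] Neg_unique[OF Comp_Hom[OF f h] Comp_Hom[OF Neg_Hom[OF f] h]] by simp

lemma Comp_Neg_left:
  assumes f: "f \<in> Hom C X Y" and h: "h \<in> Hom C Y Z" shows "Neg C h \<cdot> f = Neg C (h \<cdot> f)"
  using Comp_Add_left[OF f h Neg_Hom[OF h]] Add_Neg[OF h] Comp_Zero_left[OF f]
    Hom_Obj[OF h] Neg_unique[OF Comp_Hom[OF f h] Comp_Hom[OF f Neg_Hom[OF h]]] by simp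

lemma Neg_Zero: "\<lbrakk>X \<in> Obj C; Y \<in> Obj C\<rbrakk> \<Longrightarrow> Neg C (Zero C X Y) = Zero C X Y"
  by (rule Neg_unique[OF Zero_Hom Zero_Hom Add_Zero[OF Zero_Hom], symmetric])

lemma eq_if_difference_Zero:
  assumes f: "f \<in> Hom C X Y" and g: "g \<in> Hom C X Y"
    and d: "Add C f (Neg C g) = Zero C X Y"
  shows "f = g"
  using Neg_unique[OF f Neg_Hom[OF g] d] Neg_Neg[OF f] Neg_Neg[OF g] by metis

lemma left_cancel_if_kernel_trivial:
  assumes f: "f \<in> Hom C X Y" and g: "g \<in> Hom C X Y" and u: "u \<in> Hom C Y Z"
    and eq: "u \<cdot> f = u \<cdot> g"
    and ker: "\<And>d. \<lbrakk>d \<in> Hom C X Y; u \<cdot> d = Zero C X Z\<rbrakk> \<Longrightarrow> d = Zero C X Y"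
  shows "f = g"
proof -
  have "u \<cdot> Add C f (Neg C g) = Zero C X Z"
    using Comp_Add_right[OF f Neg_Hom[OF g] u] Comp_Neg_right[OF g u] eq
      Add_Neg[OF Comp_Hom[OF g u]] by simp
  then show ?thesis
    using ker[OF Add_Hom[OF f Neg_Hom[OF g]]] eq_if_difference_Zero[OF f g] by blast
qed

lemma right_cancel_if_cokernel_trivial:
  assumes f: "f \<in> Hom C Y Z" and g: "g \<in> Hom C Y Z" and u: "u \<in> Hom C X Y"
    and eq: "f \<cdot> u = g \<cdot> u"
    and coker: "\<And>d. \<lbrakk>d \<in> Hom C Y Z; d \<cdot> u = Zero C X Z\<rbrakk> \<Longrightarrow> d = Zero C Y Z"
  shows "f = g"
proof -
  have "Add C f (Neg C g) \<cdot> u = Zero C X Z"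
    using Comp_Add_left[OF u f Neg_Hom[OF g]] Comp_Neg_left[OF u g] eq
      Add_Neg[OF Comp_Hom[OF u g]] by simp
  then show ?thesis
    using coker[OF Add_Hom[OF f Neg_Hom[OF g]]] eq_if_difference_Zero[OF f g] by blast
qed

lemma Hom_from_zero_object:
  assumes "zero_object C Z" "f \<in> Hom C Z Y" shows "f = Zero C Z Y"
  using assms Hom_Obj[OF assms(2)] Zero_Hom unfolding zero_object_def by blast

lemma zero_object_iff_ident_Zero:
  assumes X: "X \<in> Obj C"
  shows "zero_object C X \<longleftrightarrow> ident C X = Zero C X X"
proof
  assume "zero_object C X"
  then show "ident C X = Zero C X X" using Hom_from_zero_object ident_Hom[OF X] by blast
next
  assume id: "ident C X = Zero C X X"
  have "f = Zero C X Y" if f: "f \<in> Hom C X Y" for f Y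
    using Comp_ident_right[OF f] Comp_Zero_right[OF X f] id by simp
  moreover have "f = Zero C Y X" if f: "f \<in> Hom C Y X" for f Y
    using Comp_ident_left[OF f] Comp_Zero_left[OF f X] id by simp
  ultimately show "zero_object C X"
    using X Zero_Hom unfolding zero_object_def by blast
qed

end

section \<open>Exactness of Hom on distinguished triangles\<close>

context triangulated_category
begin

lemma Sh_Obj: "X \<in> Obj C \<Longrightarrow> Sh C X \<in> Obj C"
  using Sh_bij bij_betwE by metis

lemma ShA_Zero:
  assumes "X \<in> Obj C" "Y \<in> Obj C" shows "ShA C (Zero C X Y) = Zero C (Sh C X) (Sh C Y)"
proof -
  have z: "Zero C X Y \<in> Hom C X Y" using Zero_Hom assms by blast
  show ?thesis
    using ShA_Add[OF z z] Add_Zero[OF z] Zero_if_idem[OF ShA_Hom[OF z]] by simp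
qed

lemma ShA_inject:
  "\<lbrakk>f \<in> Hom C X Y; g \<in> Hom C X Y; ShA C f = ShA C g\<rbrakk> \<Longrightarrow> f = g"
  by (rule inj_onD[OF bij_betw_imp_inj_on[OF ShA_bij]]) (simp_all add: Hom_def)

lemma ShA_full:
  assumes f: "f \<in> Hom C (Sh C X) (Sh C Y)" and X: "X \<in> Obj C" and Y: "Y \<in> Obj C"
  obtains g where "g \<in> Hom C X Y" "ShA C g = f"
proof -
  have "f \<in> Arr C" using f by (simp add: Hom_def)
  then obtain g where g: "g \<in> Arr C" "f = ShA C g"
    using ShA_bij unfolding bij_betw_def by blast
  have gH: "g \<in> Hom C (source C g) (target C g)" using g by (simp add: Hom_def)
  have "Sh C (source C g) = Sh C X" "Sh C (target C g) = Sh C Y"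
    using ShA_Hom[OF gH] f g by (auto simp: Hom_def)
  then have "source C g = X" "target C g = Y"
    using Sh_bij Hom_Obj[OF gH] X Y unfolding bij_betw_def by (auto dest: inj_onD)
  with gH g that show thesis by blast
qed

lemma zero_object_Sh: "zero_object C Z \<Longrightarrow> zero_object C (Sh C Z)"
  by (metis Sh_Obj ShA_Zero ShA_ident zero_object_def zero_object_iff_ident_Zero)

lemma rotate:
  assumes "dist_triangle C X Y Z (u, v, w)"
  shows "dist_triangle C Y Z (Sh C X) (v, w, Neg C (ShA C u))"
  using assms TR2[of X Y Z u v w] Neg_Hom[OF ShA_Hom]
  unfolding dist_triangle_def triangle_def by auto

lemma triangle_map_iff:
  assumes "dist_triangle C X Y Z (u, v, w)" "dist_triangle C X' Y' Z' (u', v', w')"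
  shows "triangle_map C (u, v, w) (u', v', w') a b c \<longleftrightarrow>
    a \<in> Hom C X X' \<and> b \<in> Hom C Y Y' \<and> c \<in> Hom C Z Z' \<and>
    b \<cdot> u = u' \<cdot> a \<and> c \<cdot> v = v' \<cdot> b \<and> ShA C a \<cdot> w = w' \<cdot> c"
proof -
  have "source C u = X" "source C v = Y" "source C w = Z"
    "source C u' = X'" "source C v' = Y'" "source C w' = Z'"
    using assms by (auto simp: dist_triangle_def triangle_def Hom_def)
  then show ?thesis by (simp add: triangle_map_def)
qed

text \<open>
  TR3 applied to a morphism from the given triangle to \<open>0 \<rightarrow> W \<rightarrow> W \<rightarrow> 0[1]\<close>, which is
  distinguished as an inverse rotation of \<open>W \<rightarrow> W \<rightarrow> 0[1] \<rightarrow> W[1]\<close>.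
\<close>

lemma factor_through_cone:
  assumes t: "dist_triangle C X Y Z (u, v, w)" and f: "f \<in> Hom C Y W"
    and fu: "f \<cdot> u = Zero C X W"
  obtains g where "g \<in> Hom C Z W" "f = g \<cdot> v"
proof -
  obtain N where N: "zero_object C N" using ex_zero_object by blast
  have W: "W \<in> Obj C" and NO: "N \<in> Obj C"
    using Hom_Obj[OF f] N by (auto simp: zero_object_def)
  have X: "X \<in> Obj C" and u: "u \<in> Hom C X Y"
    using t Hom_Obj by (auto simp: dist_triangle_def triangle_def)
  have tri: "triangle C N W W (Zero C N W, ident C W, Zero C W (Sh C N))"
    using Zero_Hom ident_Hom W NO Sh_Obj by (simp add: triangle_def)
  have "(ident C W, Zero C W (Sh C N), Neg C (ShA C (Zero C N W))) \<in> Dist C"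
    using TR1_ident[OF W zero_object_Sh[OF N]] ShA_Zero[OF NO W] Neg_Zero Sh_Obj W NO by simp
  then have t': "dist_triangle C N W W (Zero C N W, ident C W, Zero C W (Sh C N))"
    using TR2[OF tri] tri by (simp add: dist_triangle_def)
  have "f \<cdot> u = Zero C N W \<cdot> Zero C X N"
    using fu Comp_Zero_left[OF Zero_Hom[OF X NO] W] by simp
  then obtain c where "triangle_map C (u, v, w) (Zero C N W, ident C W, Zero C W (Sh C N))
      (Zero C X N) f c"
    using TR3[OF t t' Zero_Hom[OF X NO] f] by blast
  then have "c \<in> Hom C Z W" "c \<cdot> v = ident C W \<cdot> f"
    using triangle_map_iff[OF t t'] by auto
  with Comp_ident_left[OF f] that show thesis by simp
qed

text \<open>
  TR3 supplies only the third arrow of a morphism of triangles, and here the first one is wanted.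
  So it is applied to the rotations of \<open>W \<rightarrow> W \<rightarrow> 0 \<rightarrow> W[1]\<close> and of the given triangle; the
  resulting arrow \<open>W[1] \<rightarrow> X[1]\<close> is the shift of the factorisation, both sides carrying the
  sign of the rotation.
\<close>

lemma factor_through_fibre:
  assumes t: "dist_triangle C X Y Z (u, v, w)" and f: "f \<in> Hom C W Y"
    and vf: "v \<cdot> f = Zero C W Z"
  obtains g where "g \<in> Hom C W X" "f = u \<cdot> g"
proof -
  obtain N where N: "zero_object C N" using ex_zero_object by blast
  have W: "W \<in> Obj C" and NO: "N \<in> Obj C"
    using Hom_Obj[OF f] N by (auto simp: zero_object_def)
  have X: "X \<in> Obj C" and Z: "Z \<in> Obj C" and u: "u \<in> Hom C X Y" and v: "v \<in> Hom C Y Z"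
    using t Hom_Obj by (auto simp: dist_triangle_def triangle_def)
  have "dist_triangle C W W N (ident C W, Zero C W N, Zero C N (Sh C W))"
    using TR1_ident[OF W N] Zero_Hom ident_Hom W NO Sh_Obj
    by (simp add: dist_triangle_def triangle_def)
  then have s: "dist_triangle C W N (Sh C W)
      (Zero C W N, Zero C N (Sh C W), Neg C (ident C (Sh C W)))"
    using rotate ShA_ident[OF W] by fastforce
  have "Zero C N Z \<cdot> Zero C W N = v \<cdot> f"
    using vf Comp_Zero_left[OF Zero_Hom[OF W NO] Z] by simp
  then obtain c where "triangle_map C (Zero C W N, Zero C N (Sh C W), Neg C (ident C (Sh C W)))
      (v, w, Neg C (ShA C u)) f (Zero C N Z) c"
    using TR3[OF s rotate[OF t] f Zero_Hom[OF NO Z]] by blast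
  then have c: "c \<in> Hom C (Sh C W) (Sh C X)"
    and eq: "ShA C f \<cdot> Neg C (ident C (Sh C W)) = Neg C (ShA C u) \<cdot> c"
    using triangle_map_iff[OF s rotate[OF t]] by auto
  obtain g where g: "g \<in> Hom C W X" "ShA C g = c" using ShA_full[OF c W X] .
  have "Neg C (ShA C f) = Neg C (ShA C (u \<cdot> g))"
    using eq g Comp_Neg_right[OF ident_Hom[OF Sh_Obj[OF W]] ShA_Hom[OF f]]
      Comp_ident_right[OF ShA_Hom[OF f]] Comp_Neg_left[OF c ShA_Hom[OF u]] ShA_Comp[OF g(1) u]
    by simp
  then have "ShA C f = ShA C (u \<cdot> g)"
    using Neg_Neg[OF ShA_Hom[OF f]] Neg_Neg[OF ShA_Hom[OF Comp_Hom[OF g(1) u]]] by metis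
  then have "f = u \<cdot> g" using ShA_inject f Comp_Hom[OF g(1) u] by blast
  with g that show thesis by blast
qed

lemma Hom_middle_vanish:
  assumes t: "dist_triangle C X Y Z (u, v, w)"
    and XW: "Hom C X W = {Zero C X W}" and ZW: "Hom C Z W = {Zero C Z W}"
  shows "Hom C Y W = {Zero C Y W}"
proof -
  have u: "u \<in> Hom C X Y" and v: "v \<in> Hom C Y Z"
    using t by (auto simp: dist_triangle_def triangle_def)
  have W: "W \<in> Obj C" using XW Hom_Obj by blast
  have "f = Zero C Y W" if f: "f \<in> Hom C Y W" for f
  proof -
    have "f \<cdot> u = Zero C X W" using Comp_Hom[OF u f] XW by blast
    then obtain g where "g \<in> Hom C Z W" "f = g \<cdot> v" using factor_through_cone[OF t f] by blast
    then show ?thesis using ZW Comp_Zero_left[OF v W] by simp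
  qed
  then show ?thesis using Zero_Hom W Hom_Obj[OF u] by blast
qed

lemma Hom_Sh_vanish:
  assumes X: "X \<in> Obj C" and Y: "Y \<in> Obj C"
    and van: "Hom C X Y = {Zero C X Y}"
  shows "Hom C (Sh C X) (Sh C Y) = {Zero C (Sh C X) (Sh C Y)}"
proof -
  have "f = Zero C (Sh C X) (Sh C Y)" if f: "f \<in> Hom C (Sh C X) (Sh C Y)" for f
  proof -
    obtain g where "g \<in> Hom C X Y" "ShA C g = f" using ShA_full[OF f X Y] .
    with van ShA_Zero[OF X Y] show ?thesis by simp
  qed
  then show ?thesis using Zero_Hom Sh_Obj X Y by blast
qed

text \<open>
  The identity of \<open>Z\<close> kills \<open>v = 0\<close>, so it factors through \<open>w : Z \<rightarrow> X[1]\<close>; the other factor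
  lies in \<open>Hom(X[1], Z) = 0\<close>.
\<close>

lemma zero_object_if_projection_zero:
  assumes t: "dist_triangle C X Y Z (u, v, w)" and v: "v = Zero C Y Z"
    and van: "Hom C (Sh C X) Z = {Zero C (Sh C X) Z}"
  shows "zero_object C Z"
proof -
  have vH: "v \<in> Hom C Y Z" and w: "w \<in> Hom C Z (Sh C X)"
    using t by (auto simp: dist_triangle_def triangle_def)
  have Z: "Z \<in> Obj C" using Hom_Obj vH by blast
  have "ident C Z \<cdot> v = Zero C Y Z" using Comp_ident_left[OF vH] v by simp
  then obtain r where "r \<in> Hom C (Sh C X) Z" "ident C Z = r \<cdot> w"
    using factor_through_cone[OF rotate[OF t] ident_Hom[OF Z]] by blast
  then have "ident C Z = Zero C Z Z" using van Comp_Zero_left[OF w Z] by simp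
  then show ?thesis using zero_object_iff_ident_Zero[OF Z] by blast
qed

section \<open>Unique morphisms of triangles extending a given middle arrow\<close>

lemma triangle_map_ident:
  assumes "dist_triangle C X Y Z (u, v, w)"
  shows "triangle_map C (u, v, w) (u, v, w) (ident C X) (ident C Y) (ident C Z)"
proof -
  have h: "u \<in> Hom C X Y" "v \<in> Hom C Y Z" "w \<in> Hom C Z (Sh C X)"
    using assms by (auto simp: dist_triangle_def triangle_def)
  then have "X \<in> Obj C" "Y \<in> Obj C" "Z \<in> Obj C" using Hom_Obj by blast+
  with h show ?thesis
    using triangle_map_iff[OF assms assms]
    by (simp add: Comp_ident_left Comp_ident_right ident_Hom ShA_ident)
qed

lemma triangle_map_Comp:
  assumes t: "dist_triangle C X Y Z (u, v, w)" and t': "dist_triangle C X' Y' Z' (u', v', w')"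
    and t'': "dist_triangle C X'' Y'' Z'' (u'', v'', w'')"
    and m: "triangle_map C (u, v, w) (u', v', w') a b c"
    and m': "triangle_map C (u', v', w') (u'', v'', w'') a' b' c'"
  shows "triangle_map C (u, v, w) (u'', v'', w'') (a' \<cdot> a) (b' \<cdot> b) (c' \<cdot> c)"
proof -
  have h: "u \<in> Hom C X Y" "v \<in> Hom C Y Z" "w \<in> Hom C Z (Sh C X)"
    "u' \<in> Hom C X' Y'" "v' \<in> Hom C Y' Z'" "w' \<in> Hom C Z' (Sh C X')"
    "u'' \<in> Hom C X'' Y''" "v'' \<in> Hom C Y'' Z''" "w'' \<in> Hom C Z'' (Sh C X'')"
    using t t' t'' by (auto simp: dist_triangle_def triangle_def)
  have a: "a \<in> Hom C X X'" "b \<in> Hom C Y Y'" "c \<in> Hom C Z Z'"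
    "a' \<in> Hom C X' X''" "b' \<in> Hom C Y' Y''" "c' \<in> Hom C Z' Z''"
    using m m' triangle_map_iff[OF t t'] triangle_map_iff[OF t' t''] by auto
  have e: "b \<cdot> u = u' \<cdot> a" "c \<cdot> v = v' \<cdot> b" "ShA C a \<cdot> w = w' \<cdot> c"
    "b' \<cdot> u' = u'' \<cdot> a'" "c' \<cdot> v' = v'' \<cdot> b'" "ShA C a' \<cdot> w' = w'' \<cdot> c'"
    using m m' triangle_map_iff[OF t t'] triangle_map_iff[OF t' t''] by auto
  have paste: "(q' \<cdot> q) \<cdot> x = x'' \<cdot> (p' \<cdot> p)"
    if "q \<cdot> x = x' \<cdot> p" "q' \<cdot> x' = x'' \<cdot> p'"
      and "x \<in> Hom C A B" "x' \<in> Hom C A' B'" "x'' \<in> Hom C A'' B''"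
      and "p \<in> Hom C A A'" "p' \<in> Hom C A' A''" "q \<in> Hom C B B'" "q' \<in> Hom C B' B''"
    for x x' x'' p p' q q' A A' A'' B B' B''
    using that(1,2) Comp_assoc[OF that(3,8,9)] Comp_assoc[OF that(6,4,9)]
      Comp_assoc[OF that(6,7,5)] by simp
  note [simp] = paste[OF e(1,4) h(1,4,7) a(1,4,2,5)] paste[OF e(2,5) h(2,5,8) a(2,5,3,6)]
    paste[OF e(3,6) h(3,6,9) a(3,6) ShA_Hom[OF a(1)] ShA_Hom[OF a(4)]]
  show ?thesis
    using triangle_map_iff[OF t t''] ShA_Comp[OF a(1,4)] Comp_Hom[OF a(1,4)] Comp_Hom[OF a(2,5)]
      Comp_Hom[OF a(3,6)] by simp
qed

text \<open>
  For the uniqueness of the left arrow, the difference \<open>d : X \<rightarrow> X'\<close> of two candidates satisfies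
  \<open>u' d = 0\<close>.  Shifting moves this to the right-hand end of the triangle, where \<open>d[1]\<close> factors as
  \<open>X[1] \<rightarrow> Z' \<rightarrow> X'[1]\<close>.
\<close>

lemma triangle_map_unique:
  assumes t: "dist_triangle C X Y Z (u, v, w)" and t': "dist_triangle C X' Y' Z' (u', v', w')"
    and van: "Hom C (Sh C X) Z' = {Zero C (Sh C X) Z'}"
    and m: "triangle_map C (u, v, w) (u', v', w') a b c"
    and m': "triangle_map C (u, v, w) (u', v', w') a' b c'"
  shows "a = a' \<and> c = c'"
proof
  have h: "v \<in> Hom C Y Z" "w \<in> Hom C Z (Sh C X)" "u' \<in> Hom C X' Y'" "w' \<in> Hom C Z' (Sh C X')"
    using t t' by (auto simp: dist_triangle_def triangle_def)
  have a: "a \<in> Hom C X X'" "a' \<in> Hom C X X'" "c \<in> Hom C Z Z'" "c' \<in> Hom C Z Z'"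
    and e: "u' \<cdot> a = u' \<cdot> a'" "c \<cdot> v = c' \<cdot> v"
    using m m' triangle_map_iff[OF t t'] by auto
  have Z': "Z' \<in> Obj C" and X: "X \<in> Obj C" and X': "X' \<in> Obj C" and Y': "Y' \<in> Obj C"
    using h a Hom_Obj by blast+
  show "c = c'"
  proof (rule right_cancel_if_cokernel_trivial[OF a(3,4) h(1) e(2)])
    fix d assume d: "d \<in> Hom C Z Z'" "d \<cdot> v = Zero C Y Z'"
    obtain g where "g \<in> Hom C (Sh C X) Z'" "d = g \<cdot> w"
      using factor_through_cone[OF rotate[OF t] d] .
    then show "d = Zero C Z Z'" using van Comp_Zero_left[OF h(2) Z'] by simp
  qed
  show "a = a'"
  proof (rule left_cancel_if_kernel_trivial[OF a(1,2) h(3) e(1)])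
    fix d assume d: "d \<in> Hom C X X'" "u' \<cdot> d = Zero C X Y'"
    have "Neg C (ShA C u') \<cdot> ShA C d = Zero C (Sh C X) (Sh C Y')"
      using Comp_Neg_left[OF ShA_Hom[OF d(1)] ShA_Hom[OF h(3)]] ShA_Comp[OF d(1) h(3), symmetric]
        d(2) ShA_Zero[OF X Y'] Neg_Zero Sh_Obj X Y' by simp
    then obtain g where "g \<in> Hom C (Sh C X) Z'" "ShA C d = w' \<cdot> g"
      using factor_through_fibre[OF rotate[OF rotate[OF t']] ShA_Hom[OF d(1)]] by blast
    then have "ShA C d = ShA C (Zero C X X')"
      using van Comp_Zero_right[OF Sh_Obj[OF X] h(4)] ShA_Zero[OF X X'] by simp
    then show "d = Zero C X X'" using ShA_inject[OF d(1)] Zero_Hom[OF X X'] by blast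
  qed
qed

lemma ex1_triangle_map:
  assumes t: "dist_triangle C X Y Z (u, v, w)" and t': "dist_triangle C X' Y' Z' (u', v', w')"
    and b: "b \<in> Hom C Y Y'"
    and van0: "Hom C X Z' = {Zero C X Z'}"
    and van1: "Hom C (Sh C X) Z' = {Zero C (Sh C X) Z'}"
  shows "\<exists>!(a, c). triangle_map C (u, v, w) (u', v', w') a b c"
proof -
  have u: "u \<in> Hom C X Y" and v': "v' \<in> Hom C Y' Z'"
    using t t' by (auto simp: dist_triangle_def triangle_def)
  have bu: "b \<cdot> u \<in> Hom C X Y'" using Comp_Hom[OF u b] .
  have "v' \<cdot> (b \<cdot> u) = Zero C X Z'" using Comp_Hom[OF bu v'] van0 by blast
  then obtain a where a: "a \<in> Hom C X X'" "b \<cdot> u = u' \<cdot> a"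
    using factor_through_fibre[OF t' bu] by blast
  obtain c where "triangle_map C (u, v, w) (u', v', w') a b c"
    using TR3[OF t t' a(1) b a(2)] by blast
  with triangle_map_unique[OF t t' van1] show ?thesis by auto
qed

lemma triangle_map_Iso:
  assumes t: "dist_triangle C X Y Z (u, v, w)" and t': "dist_triangle C X' Y' Z' (u', v', w')"
    and b: "b \<in> Iso C Y Y'"
    and m: "triangle_map C (u, v, w) (u', v', w') a b c"
    and van: "Hom C (Sh C X) Z = {Zero C (Sh C X) Z}"
      "Hom C (Sh C X') Z' = {Zero C (Sh C X') Z'}"
      "Hom C X' Z = {Zero C X' Z}" "Hom C (Sh C X') Z = {Zero C (Sh C X') Z}"
  shows "a \<in> Iso C X X' \<and> c \<in> Iso C Z Z'"
proof -
  obtain b' where b': "b' \<in> Hom C Y' Y" "b' \<cdot> b = ident C Y" "b \<cdot> b' = ident C Y'"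
    using b by (rule Iso_inverseE)
  obtain a' c' where m': "triangle_map C (u', v', w') (u, v, w) a' b' c'"
    using ex1_triangle_map[OF t' t b'(1) van(3,4)] by auto
  have "a' \<cdot> a = ident C X \<and> c' \<cdot> c = ident C Z"
    using triangle_map_unique[OF t t van(1) _ triangle_map_ident[OF t]]
      triangle_map_Comp[OF t t' t m m'] b'(2) by simp
  moreover have "a \<cdot> a' = ident C X' \<and> c \<cdot> c' = ident C Z'"
    using triangle_map_unique[OF t' t' van(2) _ triangle_map_ident[OF t']]
      triangle_map_Comp[OF t' t t' m' m] b'(3) by simp
  ultimately show ?thesis
    using m m' triangle_map_iff[OF t t'] triangle_map_iff[OF t' t] unfolding Iso_def by blast
qed

end

section \<open>Comparing two HN-systems\<close>

context t_stability
begin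

lemma phase_Obj: "\<lbrakk>\<phi> \<in> \<Phi>; B \<in> P \<phi>\<rbrakk> \<Longrightarrow> B \<in> Obj C"
  using strictly_full by (auto simp: strictly_full_def)

lemma Hom_phase_vanish:
  assumes "\<phi> \<in> \<Phi>" "\<psi> \<in> \<Phi>" "\<phi> < \<psi>" "A \<in> P \<psi>" "B \<in> P \<phi>"
  shows "Hom C A B = {Zero C A B}"
  using Hom_vanish[OF assms, of 0] by (simp add: shift_def)

lemma Hom_unshift_phase_vanish:
  assumes "\<phi> \<in> \<Phi>" "\<psi> \<in> \<Phi>" "\<phi> < \<psi>" "A \<in> P \<psi>" "B \<in> P \<phi>"
  shows "Hom C A (inv_into (Obj C) (Sh C) B) = {Zero C A (inv_into (Obj C) (Sh C) B)}"
  using Hom_vanish[OF assms, of "-1"] by (simp add: shift_def)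

lemma hn_triangle:
  assumes "hn_system C \<Phi> P X F" "k \<le> top_index F"
  obtains u v w where "tri F k = (u, v, w)"
    "dist_triangle C (filt F (Suc k)) (filt F k) (factor F k) (u, v, w)"
proof -
  have "dist_triangle C (filt F (Suc k)) (filt F k) (factor F k) (tri F k)"
    using assms by (simp add: hn_system_def)
  with that show thesis by (cases "tri F k") auto
qed

lemma filt_Hom_vanish:
  assumes hn: "hn_system C \<Phi> P X F" and k: "k \<le> Suc (top_index F)" and W: "W \<in> Obj C"
    and van: "\<And>i. \<lbrakk>k \<le> i; i \<le> top_index F\<rbrakk> \<Longrightarrow> Hom C (factor F i) W = {Zero C (factor F i) W}"
  shows "Hom C (filt F k) W = {Zero C (filt F k) W}"
  using k van
proof (induction rule: inc_induct)
  case base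
  have "zero_object C (filt F (Suc (top_index F)))" using hn by (simp add: hn_system_def)
  then show ?case
    using Hom_from_zero_object Zero_Hom W unfolding zero_object_def by blast
next
  case (step i)
  then have i: "i \<le> top_index F" by simp
  obtain u v w where "dist_triangle C (filt F (Suc i)) (filt F i) (factor F i) (u, v, w)"
    using hn_triangle[OF hn i] .
  then show ?case
    using Hom_middle_vanish step.IH step.prems i by simp
qed

text \<open>
  The two degrees, \<open>0\<close> and \<open>-1\<close>, needed for the comparison of triangles; the second is
  \<open>Hom(F\<^sup>kX, B[-1])\<close> transported along the shift.
\<close>

lemma filt_phase_vanish:
  assumes hn: "hn_system C \<Phi> P X F" and k: "k \<le> Suc (top_index F)"
    and \<phi>: "\<phi> \<in> \<Phi>" and B: "B \<in> P \<phi>"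
    and less: "\<And>i. \<lbrakk>k \<le> i; i \<le> top_index F\<rbrakk> \<Longrightarrow> \<phi> < phase F i"
  shows "Hom C (filt F k) B = {Zero C (filt F k) B}"
    and "Hom C (Sh C (filt F k)) B = {Zero C (Sh C (filt F k)) B}"
proof -
  have BO: "B \<in> Obj C" using phase_Obj[OF \<phi> B] .
  have mem: "phase F i \<in> \<Phi>" "factor F i \<in> P (phase F i)" if "i \<le> top_index F" for i
    using hn that by (simp_all add: hn_system_def)
  show "Hom C (filt F k) B = {Zero C (filt F k) B}"
    using filt_Hom_vanish[OF hn k BO] Hom_phase_vanish[OF \<phi> mem(1) less mem(2) B] by blast
  \<comment> \<open>\<open>D = B[-1]\<close>\<close>
  define D where "D = inv_into (Obj C) (Sh C) B"
  have D: "D \<in> Obj C" "Sh C D = B"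
    using Sh_bij BO inv_into_into[of B "Sh C" "Obj C"] f_inv_into_f[of B "Sh C" "Obj C"]
    by (auto simp: D_def bij_betw_def)
  have van: "Hom C (filt F k) D = {Zero C (filt F k) D}"
    using filt_Hom_vanish[OF hn k D(1)]
      Hom_unshift_phase_vanish[OF \<phi> mem(1) less mem(2) B] unfolding D_def by blast
  then have "filt F k \<in> Obj C" using Hom_Obj by blast
  with Hom_Sh_vanish[OF _ D(1) van] D(2)
  show "Hom C (Sh C (filt F k)) B = {Zero C (Sh C (filt F k)) B}" by simp
qed

lemma hn_phase_less:
  assumes "hn_system C \<Phi> P X F" "k < i" "i \<le> top_index F"
  shows "phase F k < phase F i"
  using assms by (simp add: hn_system_def strict_mono_on_def)

lemma filt_Suc_phase_vanish:
  assumes hn: "hn_system C \<Phi> P X F" and k: "k \<le> top_index F" and B: "B \<in> P (phase F k)"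
  shows "Hom C (filt F (Suc k)) B = {Zero C (filt F (Suc k)) B}"
    and "Hom C (Sh C (filt F (Suc k))) B = {Zero C (Sh C (filt F (Suc k))) B}"
proof -
  have "phase F k \<in> \<Phi>" using hn k by (simp add: hn_system_def)
  then show "Hom C (filt F (Suc k)) B = {Zero C (filt F (Suc k)) B}"
    and "Hom C (Sh C (filt F (Suc k))) B = {Zero C (Sh C (filt F (Suc k))) B}"
    using filt_phase_vanish[OF hn _ _ B, of "Suc k"] hn_phase_less[OF hn, of k] k by auto
qed

text \<open>Otherwise \<open>X\<^sub>k\<close> would be zero, as \<open>Hom(F\<^sup>k\<^sup>+\<^sup>1X[1], X\<^sub>k) = 0\<close>.\<close>

lemma filt_projection_nonzero:
  assumes hn: "hn_system C \<Phi> P X F" and k: "k \<le> top_index F"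
  shows "Hom C (filt F k) (factor F k) \<noteq> {Zero C (filt F k) (factor F k)}"
proof
  assume "Hom C (filt F k) (factor F k) = {Zero C (filt F k) (factor F k)}"
  moreover obtain u v w where
    t: "dist_triangle C (filt F (Suc k)) (filt F k) (factor F k) (u, v, w)"
    using hn_triangle[OF hn k] .
  moreover have "factor F k \<in> P (phase F k)" "\<not> zero_object C (factor F k)"
    using hn k by (simp_all add: hn_system_def)
  ultimately show False
    using zero_object_if_projection_zero[OF t _ filt_Suc_phase_vanish(2)[OF hn k]]
    by (auto simp: dist_triangle_def triangle_def)
qed

lemma filt_nonzero:
  assumes hn: "hn_system C \<Phi> P X F" and k: "k \<le> top_index F"
  shows "\<not> zero_object C (filt F k)"
proof
  assume z: "zero_object C (filt F k)"
  have "factor F k \<in> Obj C"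
    using hn k phase_Obj by (auto simp: hn_system_def)
  with z have "Hom C (filt F k) (factor F k) = {Zero C (filt F k) (factor F k)}"
    using Hom_from_zero_object[OF z] Zero_Hom unfolding zero_object_def by blast
  with filt_projection_nonzero[OF hn k] show False by blast
qed

lemma hn_index_le_if_filt_Iso:
  assumes F: "hn_system C \<Phi> P X F" and Q: "hn_system C \<Phi> P Y Q"
    and k: "k \<le> top_index F" "k \<le> Suc (top_index Q)" and h: "h \<in> Iso C (filt F k) (filt Q k)"
  shows "k \<le> top_index Q"
proof (rule ccontr)
  assume "\<not> k \<le> top_index Q"
  with k have "k = Suc (top_index Q)" by simp
  then have "zero_object C (filt Q k)" using Q by (simp add: hn_system_def)
  with zero_object_Iso[OF h] filt_nonzero[OF F k(1)] show False by blast
qed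

text \<open>
  If \<open>\<phi>\<^sub>k < \<psi>\<^sub>k\<close>, all factors of \<open>Q\<^sup>k\<close> have phase above \<open>\<phi>\<^sub>k\<close>, so the nonzero projection
  \<open>F\<^sup>k \<rightarrow> X\<^sub>k\<close> would be a nonzero map out of \<open>F\<^sup>k \<cong> Q\<^sup>k\<close> into a lower phase.
\<close>

lemma hn_phase_le:
  assumes F: "hn_system C \<Phi> P X F" and Q: "hn_system C \<Phi> P Y Q"
    and k: "k \<le> top_index F" "k \<le> top_index Q" and h: "h \<in> Iso C (filt F k) (filt Q k)"
  shows "phase Q k \<le> phase F k"
proof (rule ccontr)
  assume "\<not> phase Q k \<le> phase F k"
  then have less: "phase F k < phase Q i" if "k \<le> i" "i \<le> top_index Q" for i
    using hn_phase_less[OF Q, of k i] that by (cases "k = i") auto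
  let ?B = "factor F k"
  have B: "phase F k \<in> \<Phi>" "?B \<in> P (phase F k)"
    using F k by (simp_all add: hn_system_def)
  have van: "Hom C (filt Q k) ?B = {Zero C (filt Q k) ?B}"
    using filt_phase_vanish(1)[OF Q _ B less] k by simp
  then have BO: "?B \<in> Obj C" using Hom_Obj by blast
  obtain h' where h: "h \<in> Hom C (filt F k) (filt Q k)" "h' \<in> Hom C (filt Q k) (filt F k)"
    "h' \<cdot> h = ident C (filt F k)"
    using h by (rule Iso_inverseE)
  have "f = Zero C (filt F k) ?B" if f: "f \<in> Hom C (filt F k) ?B" for f
  proof -
    have "f \<cdot> h' = Zero C (filt Q k) ?B" using Comp_Hom[OF h(2) f] van by blast
    then show ?thesis
      using Comp_assoc[OF h(1,2) f] h(3) Comp_ident_right[OF f] Comp_Zero_left[OF h(1) BO] by simp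
  qed
  then have "Hom C (filt F k) ?B = {Zero C (filt F k) ?B}"
    using Zero_Hom BO Hom_Obj[OF h(1)] by blast
  with filt_projection_nonzero[OF F k(1)] show False by blast
qed

lemma hn_phase_eq:
  assumes F: "hn_system C \<Phi> P X F" and Q: "hn_system C \<Phi> P Y Q"
    and k: "k \<le> top_index F" "k \<le> top_index Q" and h: "h \<in> Iso C (filt F k) (filt Q k)"
  shows "phase F k = phase Q k"
proof -
  obtain h' where "h' \<in> Iso C (filt Q k) (filt F k)" using h by (rule Iso_inverseE)
  with hn_phase_le[OF F Q k h] hn_phase_le[OF Q F k(2,1)] show ?thesis by force
qed

text \<open>
  With equal phases, \<open>F\<^sup>k\<^sup>+\<^sup>1\<close> and \<open>Q\<^sup>k\<^sup>+\<^sup>1\<close> both lie above the common phase of the two \<open>k\<close>-th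
  factors, which is what the comparison of triangles requires.
\<close>

lemma hn_step:
  assumes F: "hn_system C \<Phi> P X F" and Q: "hn_system C \<Phi> P Y Q"
    and k: "k \<le> top_index F" "k \<le> top_index Q" and h: "h \<in> Iso C (filt F k) (filt Q k)"
  shows "\<exists>!(a, c). triangle_map C (tri F k) (tri Q k) a h c"
    and "triangle_map C (tri F k) (tri Q k) a h c \<Longrightarrow>
      a \<in> Iso C (filt F (Suc k)) (filt Q (Suc k)) \<and> c \<in> Iso C (factor F k) (factor Q k)"
proof -
  obtain u v w where tF: "tri F k = (u, v, w)"
    "dist_triangle C (filt F (Suc k)) (filt F k) (factor F k) (u, v, w)"
    using hn_triangle[OF F k(1)] .
  obtain u' v' w' where tQ: "tri Q k = (u', v', w')"
    "dist_triangle C (filt Q (Suc k)) (filt Q k) (factor Q k) (u', v', w')"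
    using hn_triangle[OF Q k(2)] .
  have eq: "phase F k = phase Q k" using hn_phase_eq[OF F Q k h] .
  have "factor F k \<in> P (phase F k)" "factor Q k \<in> P (phase Q k)"
    using F Q k by (simp_all add: hn_system_def)
  then have BF: "factor F k \<in> P (phase F k)" "factor F k \<in> P (phase Q k)"
    and BQ: "factor Q k \<in> P (phase F k)" "factor Q k \<in> P (phase Q k)"
    using eq by simp_all
  note van = filt_Suc_phase_vanish[OF F k(1)] filt_Suc_phase_vanish[OF Q k(2)]
  have "h \<in> Hom C (filt F k) (filt Q k)" using h by (simp add: Iso_def)
  then show "\<exists>!(a, c). triangle_map C (tri F k) (tri Q k) a h c"
    using ex1_triangle_map[OF tF(2) tQ(2)] van BQ tF(1) tQ(1) by simp
  show "triangle_map C (tri F k) (tri Q k) a h c \<Longrightarrow>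
      a \<in> Iso C (filt F (Suc k)) (filt Q (Suc k)) \<and> c \<in> Iso C (factor F k) (factor Q k)"
    using triangle_map_Iso[OF tF(2) tQ(2) h] van BF BQ tF(1) tQ(1) by simp
qed

text \<open>
  Starting from the identity, each step takes the only morphism of triangles over the previous
  arrow, so the isomorphism of Postnikov systems can be written down by recursion with definite
  descriptions.  They are meaningful for \<open>k\<close> at most the top index of both systems, provided
  that the arrow at \<open>k\<close> is an isomorphism.
\<close>

primrec hn_filt_map ::
    "'o \<Rightarrow> ('o, 'm, 'p) hn_data \<Rightarrow> ('o, 'm, 'p) hn_data \<Rightarrow> nat \<Rightarrow> 'm" where
  "hn_filt_map X F Q 0 = ident C X"
| "hn_filt_map X F Q (Suc k) =
    fst (THE (a, c). triangle_map C (tri F k) (tri Q k) a (hn_filt_map X F Q k) c)"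

definition hn_factor_map ::
    "'o \<Rightarrow> ('o, 'm, 'p) hn_data \<Rightarrow> ('o, 'm, 'p) hn_data \<Rightarrow> nat \<Rightarrow> 'm" where
  "hn_factor_map X F Q k =
    snd (THE (a, c). triangle_map C (tri F k) (tri Q k) a (hn_filt_map X F Q k) c)"

lemma hn_filt_map_step:
  assumes F: "hn_system C \<Phi> P X F" and Q: "hn_system C \<Phi> P X Q"
    and k: "k \<le> top_index F" "k \<le> top_index Q"
    and h: "hn_filt_map X F Q k \<in> Iso C (filt F k) (filt Q k)"
  shows "triangle_map C (tri F k) (tri Q k)
    (hn_filt_map X F Q (Suc k)) (hn_filt_map X F Q k) (hn_factor_map X F Q k)"
  using theI'[OF hn_step(1)[OF F Q k h]] by (simp add: hn_factor_map_def case_prod_unfold)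

text \<open>
  The bound on \<open>k\<close> comes out of the same induction as the isomorphisms: \<open>F\<^sup>kX\<close> is nonzero for
  \<open>k\<close> up to the top index of \<open>F\<close>, so the second filtration cannot have reached \<open>0\<close> before.
\<close>

lemma hn_filt_map_Iso:
  assumes F: "hn_system C \<Phi> P X F" and Q: "hn_system C \<Phi> P X Q" and X: "X \<in> Obj C"
    and k: "k \<le> Suc (top_index F)"
  shows "k \<le> Suc (top_index Q) \<and> hn_filt_map X F Q k \<in> Iso C (filt F k) (filt Q k)"
  using k
proof (induction k)
  case 0
  show ?case using F Q ident_Iso[OF X] by (simp add: hn_system_def)
next
  case (Suc k)
  then have k: "k \<le> top_index F" by simp
  have h: "hn_filt_map X F Q k \<in> Iso C (filt F k) (filt Q k)" and "k \<le> Suc (top_index Q)"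
    using Suc by auto
  then have k': "k \<le> top_index Q" using hn_index_le_if_filt_Iso[OF F Q k _ h] by blast
  show ?case using hn_step(2)[OF F Q k k' h hn_filt_map_step[OF F Q k k' h]] k' by simp
qed

lemma hn_top_index_eq:
  assumes "hn_system C \<Phi> P X F" "hn_system C \<Phi> P X Q" "X \<in> Obj C"
  shows "top_index F = top_index Q"
  using hn_filt_map_Iso[of X F Q "Suc (top_index F)"] hn_filt_map_Iso[of X Q F "Suc (top_index Q)"]
    assms by simp

lemma hn_comparison:
  assumes F: "hn_system C \<Phi> P X F" and Q: "hn_system C \<Phi> P X Q" and X: "X \<in> Obj C"
    and k: "k \<le> top_index F"
  shows "hn_factor_map X F Q k \<in> Iso C (factor F k) (factor Q k)"
    and "triangle_map C (tri F k) (tri Q k)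
      (hn_filt_map X F Q (Suc k)) (hn_filt_map X F Q k) (hn_factor_map X F Q k)"
proof -
  have k': "k \<le> top_index Q" using hn_top_index_eq[OF F Q X] k by simp
  have h: "hn_filt_map X F Q k \<in> Iso C (filt F k) (filt Q k)"
    using hn_filt_map_Iso[OF F Q X, of k] k by simp
  show m: "triangle_map C (tri F k) (tri Q k)
      (hn_filt_map X F Q (Suc k)) (hn_filt_map X F Q k) (hn_factor_map X F Q k)"
    using hn_filt_map_step[OF F Q k k' h] .
  show "hn_factor_map X F Q k \<in> Iso C (factor F k) (factor Q k)"
    using hn_step(2)[OF F Q k k' h m] by blast
qed

lemma hn_comparison_unique:
  assumes F: "hn_system C \<Phi> P X F" and Q: "hn_system C \<Phi> P X Q" and X: "X \<in> Obj C"
    and a0: "a 0 = ident C X"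
    and m: "\<And>i. i \<le> top_index F \<Longrightarrow>
      triangle_map C (tri F i) (tri Q i) (a (Suc i)) (a i) (b i)"
  shows "k \<le> Suc (top_index F) \<Longrightarrow> a k = hn_filt_map X F Q k"
    and "k \<le> top_index F \<Longrightarrow> b k = hn_factor_map X F Q k"
proof -
  have step: "a (Suc k) = hn_filt_map X F Q (Suc k) \<and> b k = hn_factor_map X F Q k"
    if k: "k \<le> top_index F" and eq: "a k = hn_filt_map X F Q k" for k
  proof -
    have k': "k \<le> top_index Q" using hn_top_index_eq[OF F Q X] k by simp
    have h: "hn_filt_map X F Q k \<in> Iso C (filt F k) (filt Q k)"
      using hn_filt_map_Iso[OF F Q X, of k] k by simp
    show ?thesis
      using hn_step(1)[OF F Q k k' h] hn_comparison(2)[OF F Q X k] m[OF k] eq by auto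
  qed
  show a: "k \<le> Suc (top_index F) \<Longrightarrow> a k = hn_filt_map X F Q k" for k
    using a0 step by (induction k) auto
  show "k \<le> top_index F \<Longrightarrow> b k = hn_factor_map X F Q k"
    using step a by simp
qed

end

theorem theorem4p1:
  fixes T :: "('o, 'm, 'x) triangulated_category_scheme"
    and \<Phi> :: "'p::linorder set" and P :: "'p \<Rightarrow> 'o set"
    and X :: 'o and F Q :: "('o, 'm, 'p) hn_data"
  assumes "t_stability T \<Phi> P"
    and "X \<in> Obj T" and "\<not> zero_object T X"
    and "hn_system T \<Phi> P X F" and "hn_system T \<Phi> P X Q"
  shows "top_index F = top_index Q \<and>
    (\<forall>i \<le> top_index F. phase F i = phase Q i) \<and>
    (\<exists>!(a, b).
      a \<in> (\<Pi>\<^sub>E i \<in> {..top_index F + 1}. Iso T (filt F i) (filt Q i)) \<and>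
      b \<in> (\<Pi>\<^sub>E i \<in> {..top_index F}. Iso T (factor F i) (factor Q i)) \<and>
      a 0 = ident T X \<and>
      (\<forall>i \<le> top_index F. triangle_map T (tri F i) (tri Q i) (a (i + 1)) (a i) (b i)))"
    (is "_ \<and> _ \<and> (\<exists>!(a, b). ?R a b)")
proof -
  interpret t_stability T \<Phi> P by fact
  note FQ = assms(4,5) and X = assms(2)
  note iso = hn_filt_map_Iso[OF FQ X, THEN conjunct2]
  note top = hn_top_index_eq[OF FQ X]
  have phase: "phase F i = phase Q i" if "i \<le> top_index F" for i
    using hn_phase_eq[OF FQ that _ iso] that top by simp
  define a where "a = restrict (hn_filt_map X F Q) {..top_index F + 1}"
  define b where "b = restrict (hn_factor_map X F Q) {..top_index F}"
  have "a \<in> (\<Pi>\<^sub>E i \<in> {..top_index F + 1}. Iso T (filt F i) (filt Q i))"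
    using iso by (auto simp: a_def)
  moreover have "b \<in> (\<Pi>\<^sub>E i \<in> {..top_index F}. Iso T (factor F i) (factor Q i))"
    using hn_comparison(1)[OF FQ X] by (auto simp: b_def)
  moreover have "a 0 = ident T X" by (simp add: a_def)
  moreover have "triangle_map T (tri F i) (tri Q i) (a (i + 1)) (a i) (b i)"
    if "i \<le> top_index F" for i
    using hn_comparison(2)[OF FQ X that] that by (simp add: a_def b_def)
  ultimately have R: "?R a b" by blast
  have unique: "a' = a \<and> b' = b" if R': "?R a' b'" for a' b'
  proof
    have a': "a' \<in> (\<Pi>\<^sub>E i \<in> {..top_index F + 1}. Iso T (filt F i) (filt Q i))"
      and b': "b' \<in> (\<Pi>\<^sub>E i \<in> {..top_index F}. Iso T (factor F i) (factor Q i))"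
      and a0: "a' 0 = ident T X"
      and m: "\<forall>i \<le> top_index F. triangle_map T (tri F i) (tri Q i) (a' (i + 1)) (a' i) (b' i)"
      using R' by blast+
    have m': "triangle_map T (tri F i) (tri Q i) (a' (Suc i)) (a' i) (b' i)"
      if "i \<le> top_index F" for i
      using m that by simp
    note u = hn_comparison_unique[OF FQ X a0 m']
    show "a' = a"
    proof
      fix i show "a' i = a i"
        using PiE_arb[OF a', of i] u(1)[of i] by (cases "i \<le> top_index F + 1") (auto simp: a_def)
    qed
    show "b' = b"
    proof
      fix i show "b' i = b i"
        using PiE_arb[OF b', of i] u(2)[of i] by (cases "i \<le> top_index F") (auto simp: b_def)
    qed
  qed
  have "\<exists>!(a, b). ?R a b"
  proof (rule ex1I)
    show "case (a, b) of (a, b) \<Rightarrow> ?R a b" using R by simp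
  next
    fix p assume "case p of (a, b) \<Rightarrow> ?R a b"
    moreover obtain a' b' where p: "p = (a', b')" by (cases p)
    ultimately have "?R a' b'" unfolding p prod.case by blast
    from unique[OF this] show "p = (a, b)" using p by simp
  qed
  with top phase show ?thesis by blast
qed

end
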